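(* Let $\mathcal{U}\subset\mathbb{R}^2$ be an open neighbourhood of a point $(x_0,y_0)$ and let $\phi:\mathcal{U}\setminus\{(x_0,y_0)\}\to\mathbb{R}$ be a $\mathcal{C}^2$ solution to $\phi_{xx}\phi_{yy}-\phi_{xy}^2=1$. Then the isolated singularity $(x_0,y_0)$ of $\phi$ is removable if and only if the underlying conformal structure of $\phi$ around the singularity is that of a punctured disk.
   Context: It is assumed that $\phi_{xx}>0$. The isolated singularity $(x_0,y_0)$ is removable if $\phi$ extends as a $\mathcal{C}^1$ function across $(x_0,y_0)$. The underlying conformal structure of $\phi$ is the Riemann surface structure induced on the domain of $\phi$ (equivalently, on its graph) by the Riemannian metric $ds^2=\phi_{xx}\,dx^2+2\phi_{xy}\,dx\,dy+\phi_{yy}\,dy^2$. This structure around the singularity is that of a punctured disk if there is a neighbourhood $\mathcal{V}\subset\mathcal{U}$ of $(x_0,y_0)$, homeomorphic to a disk, such that $\mathcal{V}\setminus\{(x_0,y_0)\}$ with this Riemann surface structure is biholomorphic to $\{z\in\mathbb{C}:0<|z|<1\}$, with $z\to0$ corresponding to approaching $(x_0,y_0)$. Otherwise it is that of an annulus $\{z: 1<|z|<r\}$, with $|z|\to 1$ corresponding to approaching $(x_0,y_0)$. *)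

theory Defs
  imports "HOL-Analysis.Analysis"
begin

definition pdx :: "(real \<times> real \<Rightarrow> 'b::real_normed_vector) \<Rightarrow> real \<times> real \<Rightarrow> 'b" where
  "pdx f z = vector_derivative (\<lambda>t. f (t, snd z)) (at (fst z))"

definition pdy :: "(real \<times> real \<Rightarrow> 'b::real_normed_vector) \<Rightarrow> real \<times> real \<Rightarrow> 'b" where
  "pdy f z = vector_derivative (\<lambda>t. f (fst z, t)) (at (snd z))"

text \<open>The classes \<open>C\<^sup>1\<close> and \<open>C\<^sup>2\<close> are meant for open sets \<open>S\<close>.\<close>

definition C1_on :: "(real \<times> real) set \<Rightarrow> (real \<times> real \<Rightarrow> 'b::real_normed_vector) \<Rightarrow> bool" where
  "C1_on S f \<longleftrightarrow> (\<forall>z\<in>S. f differentiable (at z)) \<and>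
     continuous_on S (pdx f) \<and> continuous_on S (pdy f)"

definition C2_on :: "(real \<times> real) set \<Rightarrow> (real \<times> real \<Rightarrow> 'b::real_normed_vector) \<Rightarrow> bool" where
  "C2_on S f \<longleftrightarrow> C1_on S f \<and> C1_on S (pdx f) \<and> C1_on S (pdy f)"

text \<open>A metric assigns to each point a symmetric bilinear form on \<open>\<real> \<times> \<real>\<close>.\<close>

type_synonym metric = "real \<times> real \<Rightarrow> real \<times> real \<Rightarrow> real \<times> real \<Rightarrow> real"

definition hessian_metric :: "(real \<times> real \<Rightarrow> real) \<Rightarrow> metric" where
  "hessian_metric \<phi> z v w =
     pdx (pdx \<phi>) z * (fst v * fst w)
     + pdy (pdx \<phi>) z * (fst v * snd w + snd v * fst w)
     + pdy (pdy \<phi>) z * (snd v * snd w)"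

text \<open>
  The Riemann surface structure induced by a metric \<open>g\<close> on an open set \<open>S\<close>: its charts are the
  isothermal coordinates, i.e. the \<open>C\<^sup>1\<close> coordinates \<open>\<zeta>\<close> that pull the Euclidean metric back to a
  positive multiple of \<open>g\<close> and are positively oriented (the last condition is positivity of the
  Jacobian determinant of \<open>\<zeta>\<close>). Charts need not be smoother than \<open>C\<^sup>1\<close>, since for a \<open>C\<^sup>2\<close>
  function \<open>\<phi>\<close> the metric is a priori only continuous.
\<close>

definition isothermal_atlas ::
  "metric \<Rightarrow> (real \<times> real) set \<Rightarrow> ((real \<times> real) set \<times> (real \<times> real \<Rightarrow> complex)) set" where
  "isothermal_atlas g S = {(W, \<zeta>). open W \<and> W \<subseteq> S \<and> C1_on W \<zeta> \<and> inj_on \<zeta> W \<and>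
     (\<forall>z\<in>W. (\<exists>c>0. \<forall>v w. frechet_derivative \<zeta> (at z) v \<bullet> frechet_derivative \<zeta> (at z) w = c * g z v w)
            \<and> Im (cnj (pdx \<zeta> z) * pdy \<zeta> z) > 0)}"

text \<open>
  Both \<open>f\<close> and its inverse are holomorphic when read in charts. Transition maps between isothermal
  charts are holomorphic, so it does not matter which chart around \<open>q\<close> is used; asking for
  the existence of one makes sure that the charts cover \<open>S\<close>.
\<close>

definition biholomorphism_onto ::
  "metric \<Rightarrow> (real \<times> real) set \<Rightarrow> complex set \<Rightarrow> (real \<times> real \<Rightarrow> complex) \<Rightarrow> bool" where
  "biholomorphism_onto g S D f \<longleftrightarrow> bij_betw f S D \<and>
     (\<forall>q\<in>S. \<exists>(W, \<zeta>)\<in>isothermal_atlas g S. q \<in> W \<and>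
        (f \<circ> inv_into W \<zeta>) holomorphic_on (\<zeta> ` W) \<and>
        (\<zeta> \<circ> inv_into S f) holomorphic_on (f ` W))"

definition removable_singularity ::
  "(real \<times> real) set \<Rightarrow> real \<times> real \<Rightarrow> (real \<times> real \<Rightarrow> real) \<Rightarrow> bool" where
  "removable_singularity U p \<phi> \<longleftrightarrow> (\<exists>\<psi>. C1_on U \<psi> \<and> (\<forall>z\<in>U - {p}. \<psi> z = \<phi> z))"

text \<open>The two limits express that \<open>f z \<rightarrow> 0\<close> corresponds to \<open>z \<rightarrow> p\<close>.\<close>

definition punctured_disk_structure ::
  "(real \<times> real) set \<Rightarrow> real \<times> real \<Rightarrow> (real \<times> real \<Rightarrow> real) \<Rightarrow> bool" where
  "punctured_disk_structure U p \<phi> \<longleftrightarrow>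
     (\<exists>V f. open V \<and> p \<in> V \<and> V \<subseteq> U \<and> V homeomorphic (ball 0 1 :: complex set) \<and>
        biholomorphism_onto (hessian_metric \<phi>) (V - {p}) {z. 0 < cmod z \<and> cmod z < 1} f \<and>
        (f \<longlongrightarrow> 0) (at p) \<and> (inv_into (V - {p}) f \<longlongrightarrow> p) (at 0))"

end

theory Submission
  imports Defs "HOL-Complex_Analysis.Complex_Analysis"
begin

text \<open>
  Write \<open>P\<close>, \<open>Q\<close> for the first partial derivatives of \<open>\<phi>\<close> and \<open>H\<close> for its Hessian. Since
  \<open>det H = 1\<close>, Cayley--Hamilton gives \<open>(I + H)\<^sup>2 = (2 + tr H) H\<close>, so the map
  \<open>L = (x + P) + i (y + Q)\<close>, whose differential is \<open>I + H\<close>, is isothermal for the Hessian metric.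
  If \<open>\<phi>\<close> extends as a \<open>C\<^sup>1\<close> function, \<open>L\<close> is continuous at the singularity, and positivity of
  \<open>H\<close> makes it expanding and hence injective on a disk; the preimage under \<open>L\<close> of a small round
  disk is then the required neighbourhood.

  Conversely, \<open>x + i Q\<close> and \<open>y - i P\<close> are holomorphic for the conformal structure. On a punctured
  disk their real parts are bounded, so both extend across the puncture; thus the gradient of
  \<open>\<phi>\<close> has a limit at the singularity and \<open>\<phi>\<close> extends as a \<open>C\<^sup>1\<close> function.
\<close>

section \<open>Partial derivatives and the symmetry of second derivatives\<close>

lemma has_derivative_pdx_pdy:
  assumes "f differentiable (at z)"
  shows "(f has_derivative (\<lambda>v. fst v *\<^sub>R pdx f z + snd v *\<^sub>R pdy f z)) (at z)"
proof -
  obtain D where D: "(f has_derivative D) (at z)"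
    using assms by (auto simp: differentiable_def)
  interpret D: bounded_linear D using D by (rule has_derivative_bounded_linear)
  have f: "(f has_derivative D) (at (fst z, snd z))" using D by simp
  have "((\<lambda>t. f (t, snd z)) has_derivative (\<lambda>t. D (t, 0))) (at (fst z))"
    by (rule has_derivative_compose[where f = "\<lambda>t. (t, snd z)", OF _ f])
      (auto intro!: derivative_eq_intros)
  then have "((\<lambda>t. f (t, snd z)) has_vector_derivative D (1, 0)) (at (fst z))"
    by (simp add: has_vector_derivative_def flip: D.scaleR)
  then have x: "pdx f z = D (1, 0)" by (simp add: pdx_def vector_derivative_at)
  have "((\<lambda>t. f (fst z, t)) has_derivative (\<lambda>t. D (0, t))) (at (snd z))"
    by (rule has_derivative_compose[where f = "\<lambda>t. (fst z, t)", OF _ f])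
      (auto intro!: derivative_eq_intros)
  then have "((\<lambda>t. f (fst z, t)) has_vector_derivative D (0, 1)) (at (snd z))"
    by (simp add: has_vector_derivative_def flip: D.scaleR)
  then have y: "pdy f z = D (0, 1)" by (simp add: pdy_def vector_derivative_at)
  have "D = (\<lambda>v. fst v *\<^sub>R pdx f z + snd v *\<^sub>R pdy f z)"
    unfolding x y by (rule ext) (simp flip: D.scaleR D.add)
  then show ?thesis using D by simp
qed

lemma has_derivative_pd_unique:
  assumes "(f has_derivative (\<lambda>v. fst v *\<^sub>R a + snd v *\<^sub>R b)) (at z)"
  shows "f differentiable (at z)" "pdx f z = a" "pdy f z = b"
proof -
  show d: "f differentiable (at z)" using assms by (auto simp: differentiable_def)
  have "(\<lambda>v. fst v *\<^sub>R pdx f z + snd v *\<^sub>R pdy f z) = (\<lambda>v. fst v *\<^sub>R a + snd v *\<^sub>R b)"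
    using has_derivative_unique[OF has_derivative_pdx_pdy[OF d] assms] .
  from fun_cong[OF this, of "(1,0)"] fun_cong[OF this, of "(0,1)"]
  show "pdx f z = a" "pdy f z = b" by auto
qed

lemma pdx_field_derivative:
  fixes f :: "real \<times> real \<Rightarrow> real"
  assumes "f differentiable (at (x, y))"
  shows "((\<lambda>t. f (t, y)) has_real_derivative pdx f (x, y)) (at x)"
proof -
  have "((\<lambda>t. f (t, y)) has_derivative (\<lambda>t. t * pdx f (x, y))) (at x)"
    by (rule has_derivative_eq_rhs[OF has_derivative_compose[where f = "\<lambda>t. (t, y)",
          OF _ has_derivative_pdx_pdy[OF assms]]]) (auto intro!: derivative_eq_intros)
  then show ?thesis unfolding has_field_derivative_def by (rule has_derivative_eq_rhs) auto
qed

lemma pdy_field_derivative: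
  fixes f :: "real \<times> real \<Rightarrow> real"
  assumes "f differentiable (at (x, y))"
  shows "((\<lambda>t. f (x, t)) has_real_derivative pdy f (x, y)) (at y)"
proof -
  have "((\<lambda>t. f (x, t)) has_derivative (\<lambda>t. t * pdy f (x, y))) (at y)"
    by (rule has_derivative_eq_rhs[OF has_derivative_compose[where f = "\<lambda>t. (x, t)",
          OF _ has_derivative_pdx_pdy[OF assms]]]) (auto intro!: derivative_eq_intros)
  then show ?thesis unfolding has_field_derivative_def by (rule has_derivative_eq_rhs) auto
qed

text \<open>The mean value theorem is applied twice: in the first variable to
  \<open>f (s, b+h) - f (s, b)\<close>, then in the second to \<open>pdx f (s, t)\<close>.\<close>

lemma mixed_difference_xy:
  fixes f :: "real \<times> real \<Rightarrow> real"
  assumes h: "0 < h" and sub: "{a..a+h} \<times> {b..b+h} \<subseteq> S"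
    and f: "\<forall>z\<in>S. f differentiable (at z)" "\<forall>z\<in>S. pdx f differentiable (at z)"
  shows "\<exists>z\<in>{a..a+h} \<times> {b..b+h}.
    f (a+h, b+h) - f (a+h, b) - f (a, b+h) + f (a, b) = h\<^sup>2 * pdy (pdx f) z"
proof -
  have S: "(s, t) \<in> S" if "a \<le> s" "s \<le> a + h" "b \<le> t" "t \<le> b + h" for s t
    using that sub by auto
  have "\<exists>s>a. s < a+h \<and> (f (a+h, b+h) - f (a+h, b)) - (f (a, b+h) - f (a, b))
      = (a+h - a) * (pdx f (s, b+h) - pdx f (s, b))"
    by (rule MVT2[where f = "\<lambda>s. f (s, b+h) - f (s, b)"])
      (use h S f(1) in \<open>auto intro!: DERIV_diff pdx_field_derivative\<close>)
  then obtain s where s: "a < s" "s < a+h"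
    "(f (a+h, b+h) - f (a+h, b)) - (f (a, b+h) - f (a, b)) = h * (pdx f (s, b+h) - pdx f (s, b))"
    by auto
  have "\<exists>t>b. t < b+h \<and> pdx f (s, b+h) - pdx f (s, b) = (b+h - b) * pdy (pdx f) (s, t)"
    by (rule MVT2) (use h s S f(2) in \<open>auto intro!: pdy_field_derivative\<close>)
  then obtain t where "b < t" "t < b+h" "pdx f (s, b+h) - pdx f (s, b) = h * pdy (pdx f) (s, t)"
    by auto
  then show ?thesis using s by (intro bexI[of _ "(s, t)"]) (auto simp: power2_eq_square)
qed

text \<open>The same second difference, grouped the other way: first the second variable, then the
  first.\<close>

lemma mixed_difference_yx:
  fixes f :: "real \<times> real \<Rightarrow> real"
  assumes h: "0 < h" and sub: "{a..a+h} \<times> {b..b+h} \<subseteq> S"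
    and f: "\<forall>z\<in>S. f differentiable (at z)" "\<forall>z\<in>S. pdy f differentiable (at z)"
  shows "\<exists>z\<in>{a..a+h} \<times> {b..b+h}.
    f (a+h, b+h) - f (a+h, b) - f (a, b+h) + f (a, b) = h\<^sup>2 * pdx (pdy f) z"
proof -
  have S: "(s, t) \<in> S" if "a \<le> s" "s \<le> a + h" "b \<le> t" "t \<le> b + h" for s t
    using that sub by auto
  have "\<exists>t>b. t < b+h \<and> (f (a+h, b+h) - f (a, b+h)) - (f (a+h, b) - f (a, b))
      = (b+h - b) * (pdy f (a+h, t) - pdy f (a, t))"
    by (rule MVT2[where f = "\<lambda>t. f (a+h, t) - f (a, t)"])
      (use h S f(1) in \<open>auto intro!: DERIV_diff pdy_field_derivative\<close>)
  then obtain t where t: "b < t" "t < b+h"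
    "(f (a+h, b+h) - f (a, b+h)) - (f (a+h, b) - f (a, b)) = h * (pdy f (a+h, t) - pdy f (a, t))"
    by auto
  have "\<exists>s>a. s < a+h \<and> pdy f (a+h, t) - pdy f (a, t) = (a+h - a) * pdx (pdy f) (s, t)"
    by (rule MVT2) (use h t S f(2) in \<open>auto intro!: pdx_field_derivative\<close>)
  then obtain s where "a < s" "s < a+h" "pdy f (a+h, t) - pdy f (a, t) = h * pdx (pdy f) (s, t)"
    by auto
  then show ?thesis using t by (intro bexI[of _ "(s, t)"]) (auto simp: power2_eq_square)
qed

text \<open>Schwarz's theorem. On every small square at \<open>z\<close> the two mixed derivatives,
  each at some point of the square, equal the same difference quotient; by continuity they cannot
  differ at \<open>z\<close>.\<close>

lemma C2_on_mixed_partials_eq: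
  fixes f :: "real \<times> real \<Rightarrow> real"
  assumes "open S" "C2_on S f" "z \<in> S"
  shows "pdx (pdy f) z = pdy (pdx f) z"
proof (rule ccontr)
  assume neq: "pdx (pdy f) z \<noteq> pdy (pdx f) z"
  \<comment> \<open>Half the supposed gap: values within \<open>e\<close> of the two mixed
    derivatives at \<open>z\<close> cannot coincide.\<close>
  define e where "e = \<bar>pdx (pdy f) z - pdy (pdx f) z\<bar> / 2"
  have e: "0 < e" using neq by (simp add: e_def)
  have "isCont (pdx (pdy f)) z" "isCont (pdy (pdx f)) z"
    using assms by (auto simp: C2_on_def C1_on_def continuous_on_eq_continuous_at)
  then have "\<forall>\<^sub>F w in nhds z. dist (pdx (pdy f) w) (pdx (pdy f) z) < e"
    "\<forall>\<^sub>F w in nhds z. dist (pdy (pdx f) w) (pdy (pdx f) z) < e"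
    using e unfolding isCont_def tendsto_at_iff_tendsto_nhds by (auto dest: tendstoD)
  moreover have "\<forall>\<^sub>F w in nhds z. w \<in> S" using assms by (simp add: eventually_nhds_in_open)
  ultimately have "\<forall>\<^sub>F w in nhds z. dist (pdx (pdy f) w) (pdx (pdy f) z) < e
      \<and> dist (pdy (pdx f) w) (pdy (pdx f) z) < e \<and> w \<in> S"
    by eventually_elim auto
  then obtain d where d: "0 < d" "\<And>w. dist w z < d \<Longrightarrow> dist (pdx (pdy f) w) (pdx (pdy f) z) < e
      \<and> dist (pdy (pdx f) w) (pdy (pdx f) z) < e \<and> w \<in> S"
    by (auto simp: eventually_nhds_metric)
  obtain a b where z: "z = (a, b)" by fastforce
  \<comment> \<open>Points of the square of side \<open>h\<close> have distance at most
    \<open>2 * h < d\<close> from its corner \<open>z\<close>.\<close>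
  define h where "h = d / 3"
  have h: "0 < h" using d by (simp add: h_def)
  have near: "dist w z < d" if "w \<in> {a..a+h} \<times> {b..b+h}" for w
  proof -
    have "dist w z \<le> \<bar>fst w - a\<bar> + \<bar>snd w - b\<bar>"
      using sqrt_sum_squares_le_sum_abs by (auto simp: z dist_prod_def dist_real_def)
    also have "\<dots> \<le> h + h" using that by auto
    finally show ?thesis using d(1) by (simp add: h_def)
  qed
  have sub: "{a..a+h} \<times> {b..b+h} \<subseteq> S" using near d(2) by blast
  have diff: "\<forall>z\<in>S. f differentiable (at z)" "\<forall>z\<in>S. pdx f differentiable (at z)"
    "\<forall>z\<in>S. pdy f differentiable (at z)"
    using assms by (auto simp: C2_on_def C1_on_def)
  obtain v where v: "v \<in> {a..a+h} \<times> {b..b+h}"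
    "f (a+h, b+h) - f (a+h, b) - f (a, b+h) + f (a, b) = h\<^sup>2 * pdy (pdx f) v"
    using mixed_difference_xy[OF h sub diff(1,2)] by blast
  obtain w where w: "w \<in> {a..a+h} \<times> {b..b+h}"
    "f (a+h, b+h) - f (a+h, b) - f (a, b+h) + f (a, b) = h\<^sup>2 * pdx (pdy f) w"
    using mixed_difference_yx[OF h sub diff(1,3)] by blast
  have "pdy (pdx f) v = pdx (pdy f) w" using v w h by simp
  with d(2)[OF near[OF v(1)]] d(2)[OF near[OF w(1)]] show False
    by (auto simp: e_def dist_real_def abs_if split: if_splits)
qed

section \<open>Segments that avoid a point\<close>

text \<open>With \<open>n\<close> normal to \<open>p - z\<close>, the point \<open>p\<close> lies on
  the segment only if \<open>w + t *\<^sub>R n - z\<close> is orthogonal to \<open>n\<close> too.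
  This is a linear equation in \<open>t\<close> with leading coefficient
  \<open>n \<bullet> n\<close>, so it excludes a single \<open>t\<close>.\<close>

lemma eventually_not_in_perturbed_segment:
  fixes p z w :: "real \<times> real"
  assumes "z \<noteq> p"
  obtains n where "\<forall>\<^sub>F t in at_right 0. p \<notin> closed_segment z (w + t *\<^sub>R n)"
proof -
  define n where "n = (- snd (p - z), fst (p - z))"
  have n0: "n \<bullet> n \<noteq> 0" using assms by (auto simp: n_def prod_eq_iff)
  have np: "n \<bullet> (p - z) = 0" by (simp add: n_def inner_prod_def algebra_simps)
  have "p \<notin> closed_segment z (w + t *\<^sub>R n)" if t: "t \<noteq> - (n \<bullet> (w - z)) / (n \<bullet> n)" for t
  proof
    assume "p \<in> closed_segment z (w + t *\<^sub>R n)"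
    then obtain u where u: "p = (1 - u) *\<^sub>R z + u *\<^sub>R (w + t *\<^sub>R n)"
      by (auto simp: closed_segment_def)
    then have pz: "p - z = u *\<^sub>R (w - z + t *\<^sub>R n)" by (simp add: algebra_simps)
    then have "u \<noteq> 0" using assms by auto
    moreover have "u * (n \<bullet> (w - z) + t * (n \<bullet> n)) = 0"
      using np unfolding pz by (simp add: inner_add_right)
    ultimately have "t * (n \<bullet> n) = - (n \<bullet> (w - z))" by simp
    then show False using t n0 by (simp add: field_simps)
  qed
  moreover have "\<forall>\<^sub>F t in at_right 0. t \<noteq> - (n \<bullet> (w - z)) / (n \<bullet> n)"
    by (rule eventually_neq_at_within)
  ultimately have "\<forall>\<^sub>F t in at_right 0. p \<notin> closed_segment z (w + t *\<^sub>R n)"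
    by (auto elim: eventually_mono)
  then show ?thesis by (rule that)
qed

section \<open>Removable singularities of holomorphic functions\<close>

text \<open>Shifting \<open>F\<close> into a right half-plane makes its reciprocal bounded, so
  Riemann's theorem extends the reciprocal across \<open>a\<close>. The extended value is not zero,
  and inverting again gives the limit of \<open>F\<close>.\<close>

lemma holomorphic_bounded_Re_imp_limit:
  assumes S: "open S" "a \<in> S" and F: "F holomorphic_on S - {a}"
    and bd: "\<forall>\<^sub>F z in at a. \<bar>Re (F z)\<bar> \<le> M"
  shows "\<exists>l. (F \<longlongrightarrow> l) (at a)"
proof -
  obtain r1 where r1: "0 < r1" "ball a r1 \<subseteq> S" using S by (meson openE)
  obtain r2 where r2: "0 < r2" "\<And>z. z \<noteq> a \<Longrightarrow> dist z a < r2 \<Longrightarrow> \<bar>Re (F z)\<bar> \<le> M"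
    using bd by (auto simp: eventually_at)
  define r where "r = min r1 r2"
  have r: "0 < r" using r1 r2 by (simp add: r_def)
  \<comment> \<open>With this choice \<open>N\<close> is positive and \<open>- M + 2 * N\<close> is
    at least \<open>N\<close>.\<close>
  define N where "N = \<bar>M\<bar> + 1"
  have N: "0 < N" by (simp add: N_def)
  have Re_ge: "N \<le> Re (F z + of_real (2 * N))" if "z \<in> ball a r - {a}" for z
  proof -
    have "\<bar>Re (F z)\<bar> \<le> M" using r2(2)[of z] that by (auto simp: r_def dist_commute)
    then show ?thesis by (simp add: N_def)
  qed
  have nz: "F z + of_real (2 * N) \<noteq> 0" if "z \<in> ball a r - {a}" for z
    using Re_ge[OF that] N by (metis not_le zero_complex.sel(1))
  define Y where "Y = (\<lambda>z. inverse (F z + of_real (2 * N)))"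
  have Yhol: "Y holomorphic_on ball a r - {a}"
    unfolding Y_def using nz r1
    by (intro holomorphic_intros holomorphic_on_subset[OF F]) (auto simp: r_def)
  have "cmod (Y z) \<le> inverse N" if z: "z \<in> ball a r - {a}" for z
    using order_trans[OF Re_ge[OF z] complex_Re_le_cmod] N
    by (simp add: Y_def norm_inverse le_imp_inverse_le)
  then have "\<forall>\<^sub>F z in at a. cmod (Y z) \<le> inverse N"
    using r by (auto simp: eventually_at dist_commute intro!: exI[of _ r])
  then obtain g where g: "g holomorphic_on ball a r" "\<forall>z\<in>ball a r - {a}. g z = Y z"
    using holomorphic_on_extend_bounded[OF Yhol] r by auto
  have ga: "(g \<longlongrightarrow> g a) (at a)"
    using g(1) r holomorphic_on_imp_continuous_on continuous_on_eq_continuous_at[of "ball a r" g]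
    by (auto simp: isCont_def)
  \<comment> \<open>If \<open>g a = 0\<close>, then \<open>g\<close> is not constant, since
    \<open>Y\<close> has no zeros. By the open mapping theorem it takes a small negative real value,
    but \<open>Y\<close> has positive real part.\<close>
  have "g a \<noteq> 0"
  proof
    assume g0: "g a = 0"
    have "\<not> g constant_on ball a r"
    proof
      assume const: "g constant_on ball a r"
      have "a + of_real (r / 2) \<in> ball a r - {a}"
        using r by (simp add: dist_norm)
      moreover from this have "g (a + of_real (r / 2)) = g a"
        using r const unfolding constant_on_def by (metis DiffD1 centre_in_ball)
      ultimately have "Y (a + of_real (r / 2)) = 0" using g0 g(2) by simp
      then show False using nz \<open>a + of_real (r / 2) \<in> ball a r - {a}\<close> by (simp add: Y_def)
    qed
    then have "open (g ` ball a r)"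
      by (intro open_mapping_thm[OF g(1)]) auto
    moreover have "0 \<in> g ` ball a r" using g0 r by (metis centre_in_ball image_eqI)
    ultimately obtain e where e: "0 < e" "ball 0 e \<subseteq> g ` ball a r" by (meson openE)
    have "- of_real (e / 2) \<in> ball (0::complex) e" using e by simp
    with e(2) have "- of_real (e / 2) \<in> g ` ball a r" by (rule subsetD)
    then obtain z where z: "- of_real (e / 2) = g z" "z \<in> ball a r" by (rule imageE)
    have "z \<noteq> a" using z g0 e by auto
    then have z': "z \<in> ball a r - {a}" using z by auto
    have "0 < Re (F z + of_real (2 * N))" using Re_ge[OF z'] N by linarith
    then have "0 < Re (Y z)"
      unfolding Y_def inverse_complex.sel by (intro divide_pos_pos add_pos_nonneg) auto
    moreover have "Y z = - of_real (e / 2)" using g(2) z(1) z' by simp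
    ultimately show False using e by simp
  qed
  then have "((\<lambda>z. inverse (g z) - of_real (2 * N)) \<longlongrightarrow> inverse (g a) - of_real (2 * N)) (at a)"
    by (intro tendsto_intros ga)
  moreover have "\<forall>\<^sub>F z in at a. inverse (g z) - of_real (2 * N) = F z"
    using g(2) r by (auto simp: eventually_at dist_commute Y_def intro!: exI[of _ r])
  ultimately have "(F \<longlongrightarrow> inverse (g a) - of_real (2 * N)) (at a)"
    by (rule Lim_transform_eventually)
  then show ?thesis by (rule exI)
qed

section \<open>Isothermal charts and the Beltrami equation\<close>

text \<open>Lagrange's identity and \<open>det\<close> give \<open>Im (cnj a * b) = c\<close>. Hence
  \<open>cnj a * b\<close> is \<open>c\<close> times \<open>F + i\<close> while
  \<open>cnj a * a\<close> is \<open>c * E\<close>, and the quotient \<open>b / a\<close> no longer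
  contains \<open>c\<close>.\<close>

lemma conformal_frame_ratio:
  fixes a b :: complex
  assumes det: "E * G - F\<^sup>2 = 1" and E: "0 < E" and c: "0 < c"
    and g: "a \<bullet> a = c * E" "a \<bullet> b = c * F" "b \<bullet> b = c * G"
    and pos: "0 < Im (cnj a * b)"
  shows "a \<noteq> 0" "b * of_real E = a * Complex F 1"
proof -
  show a0: "a \<noteq> 0" using g(1) c E by auto
  have "(a \<bullet> b)\<^sup>2 + (Im (cnj a * b))\<^sup>2 = (a \<bullet> a) * (b \<bullet> b)"
    by (simp add: inner_complex_def power2_eq_square algebra_simps)
  then have "(Im (cnj a * b))\<^sup>2 = c\<^sup>2 * (E * G - F\<^sup>2)"
    unfolding g by (simp add: algebra_simps power2_eq_square)
  then have "Im (cnj a * b) = c" using det pos c by simp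
  moreover have "Re (cnj a * b) = c * F" using g(2) by (simp add: inner_complex_def)
  ultimately have ab: "cnj a * b = of_real c * Complex F 1"
    by (simp add: complex_eq_iff)
  have aa: "a * cnj a = of_real (c * E)"
    using g(1) by (simp add: complex_eq_iff inner_complex_def)
  have "of_real c * (b * of_real E) = of_real (c * E) * b" by simp
  also have "\<dots> = a * (cnj a * b)" by (simp only: aa[symmetric] mult.assoc)
  also have "\<dots> = of_real c * (a * Complex F 1)" unfolding ab by simp
  finally show "b * of_real E = a * Complex F 1" using c by simp
qed

text \<open>
  The Beltrami equation of the Hessian metric, normalised by \<open>det = 1\<close>: its solutions are the
  functions that are holomorphic in isothermal coordinates.
\<close>

definition beltrami :: "(real \<times> real \<Rightarrow> real) \<Rightarrow> (real \<times> real \<Rightarrow> complex) \<Rightarrow> real \<times> real \<Rightarrow> bool" where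
  "beltrami \<phi> X z \<longleftrightarrow> X differentiable (at z) \<and>
     pdy X z * of_real (pdx (pdx \<phi>) z) = pdx X z * Complex (pdy (pdx \<phi>) z) 1"

text \<open>The preceding lemma is applied to the images of the standard basis vectors. That
  \<open>pdx \<zeta> z\<close> does not vanish will make the differential of the chart
  invertible.\<close>

lemma isothermal_chart_beltrami:
  assumes chart: "(W, \<zeta>) \<in> isothermal_atlas (hessian_metric \<phi>) S" and z: "z \<in> W"
    and det: "pdx (pdx \<phi>) z * pdy (pdy \<phi>) z - (pdy (pdx \<phi>) z)\<^sup>2 = 1"
    and pos: "0 < pdx (pdx \<phi>) z"
  shows "beltrami \<phi> \<zeta> z" "pdx \<zeta> z \<noteq> 0"
proof -
  have diff: "\<zeta> differentiable (at z)"
    using chart z by (auto simp: isothermal_atlas_def C1_on_def)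
  have D: "frechet_derivative \<zeta> (at z) = (\<lambda>v. fst v *\<^sub>R pdx \<zeta> z + snd v *\<^sub>R pdy \<zeta> z)"
    using frechet_derivative_at[OF has_derivative_pdx_pdy[OF diff]] by simp
  obtain c where c: "0 < c" and conf: "\<And>v w. frechet_derivative \<zeta> (at z) v \<bullet> frechet_derivative \<zeta> (at z) w
      = c * hessian_metric \<phi> z v w"
    and or: "0 < Im (cnj (pdx \<zeta> z) * pdy \<zeta> z)"
    using chart z unfolding isothermal_atlas_def by blast
  have g: "pdx \<zeta> z \<bullet> pdx \<zeta> z = c * pdx (pdx \<phi>) z" "pdx \<zeta> z \<bullet> pdy \<zeta> z = c * pdy (pdx \<phi>) z"
    "pdy \<zeta> z \<bullet> pdy \<zeta> z = c * pdy (pdy \<phi>) z"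
    using conf[of "(1,0)" "(1,0)"] conf[of "(1,0)" "(0,1)"] conf[of "(0,1)" "(0,1)"]
    unfolding D by (simp_all add: hessian_metric_def)
  show "beltrami \<phi> \<zeta> z" "pdx \<zeta> z \<noteq> 0"
    using conformal_frame_ratio[OF det pos c g or] diff by (auto simp: beltrami_def)
qed

text \<open>The differential splits into the complex factor \<open>pdx X z\<close> and a real-linear
  map that depends on \<open>\<phi>\<close> alone. Differentials of two solutions therefore differ
  only by their complex factors.\<close>

lemma beltrami_has_derivative:
  assumes "beltrami \<phi> X z" "0 < pdx (pdx \<phi>) z"
  shows "(X has_derivative (\<lambda>v. pdx X z *
    (of_real (fst v) + of_real (snd v) * (Complex (pdy (pdx \<phi>) z) 1 / of_real (pdx (pdx \<phi>) z))))) (at z)"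
proof (rule has_derivative_eq_rhs)
  show "(X has_derivative (\<lambda>v. fst v *\<^sub>R pdx X z + snd v *\<^sub>R pdy X z)) (at z)"
    using assms by (auto simp: beltrami_def intro: has_derivative_pdx_pdy)
  have "pdy X z = pdx X z * (Complex (pdy (pdx \<phi>) z) 1 / of_real (pdx (pdx \<phi>) z))"
    using assms by (simp add: beltrami_def field_simps)
  then show "(\<lambda>v. fst v *\<^sub>R pdx X z + snd v *\<^sub>R pdy X z) = (\<lambda>v. pdx X z *
    (of_real (fst v) + of_real (snd v) * (Complex (pdy (pdx \<phi>) z) 1 / of_real (pdx (pdx \<phi>) z))))"
    by (simp add: fun_eq_iff scaleR_conv_of_real algebra_simps)
qed

text \<open>Invariance of domain, as charts are continuous and injective on an open set of the same
  real dimension.\<close>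

lemma isothermal_chart_image:
  assumes "(W, \<zeta>) \<in> isothermal_atlas g S"
  shows "open (\<zeta> ` W)" "continuous_on (\<zeta> ` W) (inv_into W \<zeta>)"
proof -
  have W: "open W" "inj_on \<zeta> W" "continuous_on W \<zeta>"
    using assms by (auto simp: isothermal_atlas_def C1_on_def continuous_on_eq_continuous_at
      intro: differentiable_imp_continuous_within)
  show "open (\<zeta> ` W)" by (rule invariance_of_domain_gen) (use W in auto)
  show "continuous_on (\<zeta> ` W) (inv_into W \<zeta>)"
    by (rule continuous_on_inverse_open) (use W in auto)
qed

text \<open>\<open>X\<close> and the chart have differentials with a common real-linear factor. It
  cancels when one is composed with the inverse of the other, leaving multiplication by a complex
  number.\<close>

lemma beltrami_holomorphic_in_chart:
  assumes chart: "(W, \<zeta>) \<in> isothermal_atlas (hessian_metric \<phi>) S"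
    and det: "\<forall>z\<in>W. pdx (pdx \<phi>) z * pdy (pdy \<phi>) z - (pdy (pdx \<phi>) z)\<^sup>2 = 1"
    and pos: "\<forall>z\<in>W. 0 < pdx (pdx \<phi>) z"
    and X: "\<forall>z\<in>W. beltrami \<phi> X z"
  shows "(X \<circ> inv_into W \<zeta>) holomorphic_on (\<zeta> ` W)"
proof -
  have W: "open W" "inj_on \<zeta> W" using chart by (auto simp: isothermal_atlas_def)
  have "\<exists>m. ((X \<circ> inv_into W \<zeta>) has_field_derivative m) (at w)" if w: "w \<in> \<zeta> ` W" for w
  proof -
    define z where "z = inv_into W \<zeta> w"
    have z: "z \<in> W" "\<zeta> z = w" using w by (auto simp: z_def inv_into_into f_inv_into_f)
    define E F where "E = pdx (pdx \<phi>) z" and "F = pdy (pdx \<phi>) z"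
    have E: "0 < E" using pos z by (simp add: E_def)
    \<comment> \<open>Every solution has its differential at \<open>z\<close> proportional to dx +
      \<open>\<kappa>\<close> dy.\<close>
    define \<kappa> where "\<kappa> = Complex F 1 / of_real E"
    define a b where "a = pdx \<zeta> z" and "b = pdx X z"
    have a: "a \<noteq> 0" using isothermal_chart_beltrami[OF chart z(1)] det pos z by (simp add: a_def)
    define A where "A = (\<lambda>v. a * (of_real (fst v) + of_real (snd v) * \<kappa>))"
    define B where "B = (\<lambda>v. b * (of_real (fst v) + of_real (snd v) * \<kappa>))"
    \<comment> \<open>The inverse of \<open>A\<close>, found by solving x + y
      \<open>\<kappa>\<close> = \<open>u / a\<close> for real x and y, where \<open>\<kappa>\<close>
      has real part \<open>F / E\<close> and imaginary part \<open>1 / E\<close>.\<close>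
    define A' where "A' = (\<lambda>u. (Re (u / a) - F * Im (u / a), E * Im (u / a)))"
    have dz: "(\<zeta> has_derivative A) (at z)" and dX: "(X has_derivative B) (at z)"
      using beltrami_has_derivative[of \<phi> _ z] isothermal_chart_beltrami[OF chart z(1)] det pos X z
      by (auto simp: A_def B_def a_def b_def \<kappa>_def E_def F_def)
    have Re_Im_\<kappa>: "Re \<kappa> = F / E" "Im \<kappa> = 1 / E" by (simp_all add: \<kappa>_def)
    have core: "of_real (fst (A' u)) + of_real (snd (A' u)) * \<kappa> = u / a" for u
      unfolding complex_eq_iff A'_def fst_conv snd_conv
      using E by (simp add: Re_Im_\<kappa>)
    have "A' (A v) = v" for v
    proof -
      have "A v / a = of_real (fst v) + of_real (snd v) * \<kappa>" using a by (simp add: A_def)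
      then show ?thesis using E by (simp add: A'_def Re_Im_\<kappa> prod_eq_iff)
    qed
    then have A'A: "A' \<circ> A = id" by auto
    have "linear A'"
    proof (rule linearI)
      have "t *\<^sub>R u / a = of_real t * (u / a)" for t u by (simp add: scaleR_conv_of_real)
      then have "Re (t *\<^sub>R u / a) = t * Re (u / a)" "Im (t *\<^sub>R u / a) = t * Im (u / a)" for t u
        by (simp_all only: Re_complex_of_real Im_complex_of_real times_complex.sel)
      then show "A' (t *\<^sub>R u) = t *\<^sub>R A' u" for t u
        by (simp add: A'_def algebra_simps)
    qed (simp add: A'_def add_divide_distrib algebra_simps)
    then have blA': "bounded_linear A'" by (simp add: linear_conv_bounded_linear)
    have cont: "continuous (at w) (inv_into W \<zeta>)"
      using isothermal_chart_image[OF chart] w continuous_on_eq_continuous_at by blast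
    \<comment> \<open>A continuous inverse is differentiable wherever the original map has an
      invertible differential.\<close>
    have "(inv_into W \<zeta> has_derivative A') (at w)"
      by (rule has_derivative_inverse_basic[OF _ blA' A'A cont isothermal_chart_image(1)[OF chart] w])
        (use dz in \<open>auto simp: z_def f_inv_into_f\<close>)
    then have "(X \<circ> inv_into W \<zeta> has_derivative (\<lambda>u. B (A' u))) (at w)"
      unfolding o_def by (rule has_derivative_compose) (use dX in \<open>simp add: z_def\<close>)
    moreover have "(\<lambda>u. B (A' u)) = (*) (b / a)"
      by (simp add: B_def core fun_eq_iff)
    ultimately show ?thesis by (auto simp: has_field_derivative_def)
  qed
  then show ?thesis
    using isothermal_chart_image(1)[OF chart] by (simp add: holomorphic_on_open)
qed

text \<open>Locally the map factors through a chart, as \<open>X \<circ> inv_into W \<zeta>\<close>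
  after \<open>\<zeta> \<circ> inv_into S f\<close>, and both factors are holomorphic.\<close>

lemma beltrami_holomorphic_of_biholomorphism:
  assumes bi: "biholomorphism_onto (hessian_metric \<phi>) S D f" and D: "open D"
    and det: "\<forall>z\<in>S. pdx (pdx \<phi>) z * pdy (pdy \<phi>) z - (pdy (pdx \<phi>) z)\<^sup>2 = 1"
    and pos: "\<forall>z\<in>S. 0 < pdx (pdx \<phi>) z"
    and X: "\<forall>z\<in>S. beltrami \<phi> X z"
  shows "(X \<circ> inv_into S f) holomorphic_on D"
proof -
  have bij: "bij_betw f S D" using bi by (simp add: biholomorphism_onto_def)
  then have inj: "inj_on f S" by (simp add: bij_betw_def)
  have "(X \<circ> inv_into S f) field_differentiable (at w)" if w: "w \<in> D" for w
  proof -
    define q where "q = inv_into S f w"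
    have q: "q \<in> S" "f q = w"
      using bij w by (auto simp: q_def bij_betw_def inv_into_into f_inv_into_f)
    obtain W \<zeta> where chart: "(W, \<zeta>) \<in> isothermal_atlas (hessian_metric \<phi>) S" and qW: "q \<in> W"
      and h1: "(f \<circ> inv_into W \<zeta>) holomorphic_on (\<zeta> ` W)"
      and h2: "(\<zeta> \<circ> inv_into S f) holomorphic_on (f ` W)"
      using bi q unfolding biholomorphism_onto_def by blast
    have W: "W \<subseteq> S" "inj_on \<zeta> W" using chart by (auto simp: isothermal_atlas_def)
    have im: "(f \<circ> inv_into W \<zeta>) ` (\<zeta> ` W) = f ` W"
      using W by (auto simp: image_image)
    \<comment> \<open>\<open>f\<close> need not be continuous by assumption, so openness of the
      image of \<open>W\<close> comes from its holomorphic expression in the chart.\<close>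
    have "open ((f \<circ> inv_into W \<zeta>) ` (\<zeta> ` W))"
    proof (rule invariance_of_domain)
      show "continuous_on (\<zeta> ` W) (f \<circ> inv_into W \<zeta>)" using h1 by (rule holomorphic_on_imp_continuous_on)
      show "inj_on (f \<circ> inv_into W \<zeta>) (\<zeta> ` W)"
        using W inj by (auto intro!: inj_onI dest!: inj_onD[OF inj])
    qed (rule isothermal_chart_image(1)[OF chart])
    then have op: "open (f ` W)" by (simp only: im)
    have "(X \<circ> inv_into W \<zeta>) holomorphic_on (\<zeta> ` W)"
      using beltrami_holomorphic_in_chart[OF chart] det pos X W by blast
    then have "((X \<circ> inv_into W \<zeta>) \<circ> (\<zeta> \<circ> inv_into S f)) holomorphic_on (f ` W)"
      by (rule holomorphic_on_compose_gen[OF h2]) (use W inj in \<open>auto simp: inv_into_f_f subset_iff\<close>)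
    then have "(X \<circ> inv_into S f) holomorphic_on (f ` W)"
      by (rule holomorphic_transform) (use W inj in \<open>auto simp: inv_into_f_f subset_iff\<close>)
    then show ?thesis using op q qW by (meson holomorphic_on_imp_differentiable_at imageI)
  qed
  then show ?thesis by (simp add: holomorphic_on_def field_differentiable_at_within)
qed

text \<open>
  Estimates obtained from the mean value theorem need the segment to avoid the singularity \<open>p\<close>.
  Segments through \<open>p\<close> are reached as limits of such segments, by moving one endpoint sideways.
\<close>

lemma segment_closed_condition_extends:
  fixes a b :: "real \<times> real \<Rightarrow> real"
  assumes "open B" "z \<noteq> p" "w \<in> B"
    and cont: "isCont a w" "isCont b w"
    and le: "\<And>w'. w' \<in> B \<Longrightarrow> p \<notin> closed_segment z w' \<Longrightarrow> a w' \<le> b w'"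
  shows "a w \<le> b w"
proof -
  obtain n where n: "\<forall>\<^sub>F t in at_right 0. p \<notin> closed_segment z (w + t *\<^sub>R n)"
    using eventually_not_in_perturbed_segment[OF assms(2)] .
  have lim: "((\<lambda>t. w + t *\<^sub>R n) \<longlongrightarrow> w) (at_right 0)"
    by (auto intro!: tendsto_eq_intros)
  have "\<forall>\<^sub>F t in at_right 0. w + t *\<^sub>R n \<in> B"
    using topological_tendstoD[OF lim assms(1,3)] .
  with n have "\<forall>\<^sub>F t in at_right 0. a (w + t *\<^sub>R n) \<le> b (w + t *\<^sub>R n)"
    by eventually_elim (rule le)
  then show ?thesis
    by (rule tendsto_le[OF trivial_limit_at_right_real isCont_tendsto_compose[OF cont(2) lim]
          isCont_tendsto_compose[OF cont(1) lim]])
qed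

section \<open>Extending a function across a point by the limit of its gradient\<close>

lemma pd_transform_open:
  assumes "open S" "z \<in> S" "\<And>w. w \<in> S \<Longrightarrow> g w = f w" "f differentiable (at z)"
  shows "g differentiable (at z)" "pdx g z = pdx f z" "pdy g z = pdy f z"
  using has_derivative_pd_unique[OF has_derivative_transform_within_open[OF
      has_derivative_pdx_pdy[OF assms(4)] assms(1,2), of g]] assms(3) by auto

lemma continuous_on_insert_limit:
  fixes g :: "'a::t2_space \<Rightarrow> 'b::topological_space"
  assumes "open U" "continuous_on (U - {p}) f" "\<And>z. z \<in> U - {p} \<Longrightarrow> g z = f z"
    and "(f \<longlongrightarrow> g p) (at p)"
  shows "continuous_on U g"
proof -
  have "isCont g z" if "z \<in> U" for z
  proof (cases "z = p")
    case True
    have "\<forall>\<^sub>F w in at p. f w = g w"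
      using assms(1,3) that True by (auto simp: eventually_at_topological)
    with assms(4) have "(g \<longlongrightarrow> g p) (at p)" by (rule Lim_transform_eventually)
    then show ?thesis by (simp add: isCont_def True)
  next
    case False
    have "continuous_on (U - {p}) g" using assms(2,3) by (metis (no_types, lifting) continuous_on_cong)
    then show ?thesis
      using assms(1) that False by (simp add: continuous_on_eq_continuous_at open_delete)
  qed
  then show ?thesis by (simp add: continuous_at_imp_continuous_on)
qed

text \<open>Subtracting the linear function with gradient \<open>(a, b)\<close> leaves
  \<open>h\<close>, whose gradient tends to zero. So \<open>h\<close> has arbitrarily small
  Lipschitz constants on small punctured balls: one finite constant yields a limit at
  \<open>p\<close>, and arbitrarily small ones yield differentiability there.\<close>

lemma limit_gradient_imp_removable:
  fixes \<phi> :: "real \<times> real \<Rightarrow> real"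
  assumes U: "open U" "p \<in> U" and \<phi>: "C1_on (U - {p}) \<phi>"
    and lim: "(pdx \<phi> \<longlongrightarrow> a) (at p)" "(pdy \<phi> \<longlongrightarrow> b) (at p)"
  shows "removable_singularity U p \<phi>"
proof -
  have diff: "\<phi> differentiable (at z)" if "z \<in> U - {p}" for z
    using \<phi> that by (auto simp: C1_on_def)
  define h where "h = (\<lambda>z. \<phi> z - (a * fst z + b * snd z))"
  have dh: "(h has_derivative (\<lambda>v. fst v * (pdx \<phi> z - a) + snd v * (pdy \<phi> z - b))) (at z)"
    if "z \<in> U - {p}" for z
    unfolding h_def
    by (rule has_derivative_eq_rhs, (rule derivative_intros has_derivative_pdx_pdy[OF diff[OF that]])+)
      (simp add: fun_eq_iff algebra_simps)
  have conth: "isCont h z" if "z \<in> U - {p}" for z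
    using dh[OF that] by (rule has_derivative_continuous)
  have lip: "\<exists>r>0. ball p r \<subseteq> U \<and> (\<forall>z\<in>ball p r - {p}. \<forall>w\<in>ball p r - {p}. \<bar>h z - h w\<bar> \<le> e * norm (z - w))"
    if e: "0 < e" for e
  proof -
    have "\<forall>\<^sub>F z in at p. dist (pdx \<phi> z) a < e / 2" "\<forall>\<^sub>F z in at p. dist (pdy \<phi> z) b < e / 2"
      by (rule tendstoD[OF lim(1)] tendstoD[OF lim(2)], use e in simp)+
    moreover have "\<forall>\<^sub>F z in at p. z \<in> U"
      using U by (auto simp: eventually_at_topological)
    ultimately have "\<forall>\<^sub>F z in at p. dist (pdx \<phi> z) a < e / 2 \<and> dist (pdy \<phi> z) b < e / 2 \<and> z \<in> U"
      by eventually_elim auto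
    then obtain r where r0: "0 < r" "\<And>z. z \<noteq> p \<Longrightarrow> dist z p < r \<Longrightarrow>
        dist (pdx \<phi> z) a < e / 2 \<and> dist (pdy \<phi> z) b < e / 2 \<and> z \<in> U"
      unfolding eventually_at by blast
    have r: "\<bar>pdx \<phi> z - a\<bar> \<le> e / 2" "\<bar>pdy \<phi> z - b\<bar> \<le> e / 2" "z \<in> U"
      if "z \<in> ball p r - {p}" for z
      using r0(2)[of z] that by (auto simp: dist_commute[of p] dist_real_def)
    have seg: "\<bar>h z - h w\<bar> \<le> e * norm (z - w)"
      if zw: "z \<in> ball p r" "w \<in> ball p r" "p \<notin> closed_segment z w" for z w
    proof -
      have sub: "closed_segment z w \<subseteq> ball p r - {p}"
        using zw closed_segment_subset[of z "ball p r" w] by auto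
      have "norm (h z - h w) \<le> e * norm (z - w)"
      proof (rule differentiable_bound[OF convex_closed_segment])
        fix x assume x: "x \<in> closed_segment z w"
        then have x': "x \<in> ball p r - {p}" using sub by blast
        then have "x \<in> U - {p}" using r(3) by auto
        then show "(h has_derivative (\<lambda>v. fst v * (pdx \<phi> x - a) + snd v * (pdy \<phi> x - b)))
            (at x within closed_segment z w)"
          by (rule has_derivative_at_withinI[OF dh])
        show "onorm (\<lambda>v. fst v * (pdx \<phi> x - a) + snd v * (pdy \<phi> x - b)) \<le> e"
        proof (rule onorm_le)
          fix v :: "real \<times> real"
          have "\<bar>fst v\<bar> \<le> norm v" "\<bar>snd v\<bar> \<le> norm v"
            using norm_fst_le[of "fst v" "snd v"] norm_snd_le[of "snd v" "fst v"] by auto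
          then have "\<bar>fst v\<bar> * \<bar>pdx \<phi> x - a\<bar> \<le> norm v * (e / 2)"
            "\<bar>snd v\<bar> * \<bar>pdy \<phi> x - b\<bar> \<le> norm v * (e / 2)"
            using r(1,2)[OF x'] by (intro mult_mono; simp)+
          then have "\<bar>fst v * (pdx \<phi> x - a) + snd v * (pdy \<phi> x - b)\<bar> \<le> norm v * (e / 2) + norm v * (e / 2)"
            by (intro order_trans[OF abs_triangle_ineq] add_mono) (simp_all only: abs_mult)
          then show "norm (fst v * (pdx \<phi> x - a) + snd v * (pdy \<phi> x - b)) \<le> e * norm v"
            by (simp add: algebra_simps)
        qed
      qed auto
      then show ?thesis by simp
    qed
    \<comment> \<open>The punctured ball is not convex; pairs whose segment meets \<open>p\<close>
      are limits of pairs covered by \<open>seg\<close>.\<close>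
    have "\<bar>h z - h w\<bar> \<le> e * norm (z - w)" if zw: "z \<in> ball p r - {p}" "w \<in> ball p r - {p}" for z w
    proof (rule segment_closed_condition_extends[where B = "ball p r" and z = z and p = p
          and a = "\<lambda>w. \<bar>h z - h w\<bar>" and b = "\<lambda>w. e * norm (z - w)"])
      have "w \<in> U - {p}" using r(3) zw by auto
      then show "isCont (\<lambda>w. \<bar>h z - h w\<bar>) w" by (intro continuous_intros conth)
    qed (use zw seg in \<open>auto intro!: continuous_intros\<close>)
    moreover have "ball p r \<subseteq> U" using r(3) U(2) by blast
    ultimately show ?thesis using r0(1) by blast
  qed
  obtain r1 where r1: "0 < r1" "\<forall>z\<in>ball p r1 - {p}. \<forall>w\<in>ball p r1 - {p}. \<bar>h z - h w\<bar> \<le> 1 * norm (z - w)"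
    using lip[of 1] by auto
  have "uniformly_continuous_on (ball p r1 - {p}) h"
    unfolding uniformly_continuous_on_def dist_norm real_norm_def
  proof (intro allI impI)
    fix e :: real assume "0 < e"
    moreover have "\<bar>h w - h z\<bar> < e"
      if "z \<in> ball p r1 - {p}" "w \<in> ball p r1 - {p}" "norm (w - z) < e" for z w
      using r1(2)[rule_format, OF that(2,1)] that(3) by linarith
    ultimately show "\<exists>d>0. \<forall>z\<in>ball p r1 - {p}. \<forall>w\<in>ball p r1 - {p}.
        norm (w - z) < d \<longrightarrow> \<bar>h w - h z\<bar> < e" by blast
  qed
  moreover have "p \<in> closure (ball p r1 - {p})"
    using r1(1) by (simp add: interior_limit_point flip: islimpt_in_closure)
  ultimately obtain l where "(h \<longlongrightarrow> l) (at p within (ball p r1 - {p}))"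
    by (rule uniformly_continuous_on_extension_at_closure)
  moreover have "at p within (ball p r1 - {p}) = at p"
    using r1(1) at_within_open[of p "ball p r1"] by (simp add: at_within_def)
  ultimately have hl: "(h \<longlongrightarrow> l) (at p)" by simp
  \<comment> \<open>The value at \<open>p\<close> is the limit \<open>l\<close> of \<open>h\<close>
    with the subtracted linear part restored.\<close>
  define \<psi> where "\<psi> = (\<lambda>z. if z = p then l + (a * fst p + b * snd p) else \<phi> z)"
  have dp: "(\<psi> has_derivative (\<lambda>v. fst v *\<^sub>R a + snd v *\<^sub>R b)) (at p)"
    unfolding has_derivative_at_alt
  proof (intro conjI allI impI)
    show "bounded_linear (\<lambda>v. fst v *\<^sub>R a + snd v *\<^sub>R b)"
      by (intro bounded_linear_intros)
    fix e :: real assume "0 < e"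
    then obtain r where r: "0 < r" "\<forall>z\<in>ball p r - {p}. \<forall>w\<in>ball p r - {p}. \<bar>h z - h w\<bar> \<le> e * norm (z - w)"
      using lip by blast
    \<comment> \<open>Let \<open>w\<close> tend to \<open>p\<close> in the Lipschitz
      estimate.\<close>
    have "\<bar>h z - l\<bar> \<le> e * norm (z - p)" if z: "z \<in> ball p r - {p}" for z
    proof (rule tendsto_le[OF at_neq_bot[of p]])
      show "((\<lambda>w. \<bar>h z - h w\<bar>) \<longlongrightarrow> \<bar>h z - l\<bar>) (at p)" by (intro tendsto_intros hl)
      show "((\<lambda>w. e * norm (z - w)) \<longlongrightarrow> e * norm (z - p)) (at p)" by (intro tendsto_intros)
      show "\<forall>\<^sub>F w in at p. \<bar>h z - h w\<bar> \<le> e * norm (z - w)"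
        using r z by (auto simp: eventually_at dist_commute intro!: exI[of _ r])
    qed
    then show "\<exists>d>0. \<forall>y. norm (y - p) < d \<longrightarrow>
        norm (\<psi> y - \<psi> p - (fst (y - p) *\<^sub>R a + snd (y - p) *\<^sub>R b)) \<le> e * norm (y - p)"
      using r(1) by (intro exI[of _ r]) (auto simp: \<psi>_def h_def dist_norm norm_minus_commute algebra_simps)
  qed
  note dp' = has_derivative_pd_unique[OF dp]
  have away: "\<psi> differentiable (at z)" "pdx \<psi> z = pdx \<phi> z" "pdy \<psi> z = pdy \<phi> z" if "z \<in> U - {p}" for z
    using pd_transform_open[of "U - {p}" z \<psi> \<phi>] diff that U by (auto simp: \<psi>_def open_delete)
  have "C1_on U \<psi>"
    unfolding C1_on_def
  proof (intro conjI ballI)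
    show "\<psi> differentiable (at z)" if "z \<in> U" for z using away(1) dp'(1) that by blast
    show "continuous_on U (pdx \<psi>)"
      by (rule continuous_on_insert_limit[where f = "pdx \<phi>" and p = p])
        (use U \<phi> lim dp' away in \<open>auto simp: C1_on_def\<close>)
    show "continuous_on U (pdy \<psi>)"
      by (rule continuous_on_insert_limit[where f = "pdy \<phi>" and p = p])
        (use U \<phi> lim dp' away in \<open>auto simp: C1_on_def\<close>)
  qed
  moreover have "\<forall>z\<in>U - {p}. \<psi> z = \<phi> z" by (simp add: \<psi>_def)
  ultimately show ?thesis unfolding removable_singularity_def by blast
qed

lemma C2_on_differentiable:
  assumes "C2_on S f" "z \<in> S"
  shows "f differentiable (at z)" "pdx f differentiable (at z)" "pdy f differentiable (at z)"
  using assms by (auto simp: C2_on_def C1_on_def)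

lemma det_one_coeff_pos:
  fixes E F G :: real
  assumes "E * G - F\<^sup>2 = 1" "0 < E"
  shows "0 < G"
proof -
  have "E * G = 1 + F\<^sup>2" using assms by simp
  then have "0 < E * G" by (simp add: add_pos_nonneg)
  then show ?thesis using assms(2) by (simp add: zero_less_mult_iff)
qed

lemma has_derivative_Complex:
  fixes f g :: "real \<times> real \<Rightarrow> real"
  assumes "(f has_derivative f') (at z)" "(g has_derivative g') (at z)"
  shows "((\<lambda>w. Complex (f w) (g w)) has_derivative (\<lambda>v. Complex (f' v) (g' v))) (at z)"
proof -
  have "((\<lambda>w. f w *\<^sub>R 1 + g w *\<^sub>R \<i>) has_derivative (\<lambda>v. f' v *\<^sub>R 1 + g' v *\<^sub>R \<i>)) (at z)"
    by (intro derivative_intros assms)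
  then show ?thesis by (simp add: Complex_eq scaleR_conv_of_real mult.commute)
qed

section \<open>The Hessian metric around the singularity\<close>

context
  fixes U :: "(real \<times> real) set" and p :: "real \<times> real" and \<phi> :: "real \<times> real \<Rightarrow> real"
  assumes U: "open U" "p \<in> U" and C2: "C2_on (U - {p}) \<phi>"
    and det: "\<And>z. z \<in> U - {p} \<Longrightarrow> pdx (pdx \<phi>) z * pdy (pdy \<phi>) z - (pdy (pdx \<phi>) z)\<^sup>2 = 1"
    and pos: "\<And>z. z \<in> U - {p} \<Longrightarrow> 0 < pdx (pdx \<phi>) z"
begin

lemma hessian_symmetric: "z \<in> U - {p} \<Longrightarrow> pdx (pdy \<phi>) z = pdy (pdx \<phi>) z"
  using C2_on_mixed_partials_eq[OF _ C2] U by (simp add: open_delete)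

lemma has_derivative_gradient:
  assumes "z \<in> U - {p}"
  shows "(pdx \<phi> has_derivative (\<lambda>v. fst v * pdx (pdx \<phi>) z + snd v * pdy (pdx \<phi>) z)) (at z)"
    "(pdy \<phi> has_derivative (\<lambda>v. fst v * pdy (pdx \<phi>) z + snd v * pdy (pdy \<phi>) z)) (at z)"
  using has_derivative_pdx_pdy[OF C2_on_differentiable(2)[OF C2 assms]]
    has_derivative_pdx_pdy[OF C2_on_differentiable(3)[OF C2 assms]] hessian_symmetric[OF assms] by auto

text \<open>For the function x + i \<open>pdy \<phi>\<close> the Beltrami equation is exactly the
  Monge-Ampere equation \<open>det\<close>.\<close>

lemma beltrami_conjugate_x:
  assumes "z \<in> U - {p}"
  shows "beltrami \<phi> (\<lambda>w. Complex (fst w) (pdy \<phi> w)) z"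
proof -
  have "((\<lambda>w. Complex (fst w) (pdy \<phi> w)) has_derivative
    (\<lambda>v. fst v *\<^sub>R Complex 1 (pdy (pdx \<phi>) z) + snd v *\<^sub>R Complex 0 (pdy (pdy \<phi>) z))) (at z)"
    by (rule has_derivative_eq_rhs[OF has_derivative_Complex[OF
          has_derivative_fst[OF has_derivative_ident] has_derivative_gradient(2)[OF assms]]])
      (simp add: fun_eq_iff complex_eq_iff)
  note this = has_derivative_pd_unique[OF this]
  then show ?thesis
    using det[OF assms] by (simp add: beltrami_def complex_eq_iff power2_eq_square algebra_simps)
qed

text \<open>With E and F for \<open>pdx (pdx \<phi>) z\<close> and
  \<open>pdy (pdx \<phi>) z\<close>, both sides of the equation are E - i E F.\<close>

lemma beltrami_conjugate_y:
  assumes "z \<in> U - {p}"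
  shows "beltrami \<phi> (\<lambda>w. Complex (snd w) (- pdx \<phi> w)) z"
proof -
  have "((\<lambda>w. Complex (snd w) (- pdx \<phi> w)) has_derivative
    (\<lambda>v. fst v *\<^sub>R Complex 0 (- pdx (pdx \<phi>) z) + snd v *\<^sub>R Complex 1 (- pdy (pdx \<phi>) z))) (at z)"
    by (rule has_derivative_eq_rhs[OF has_derivative_Complex[OF
          has_derivative_snd[OF has_derivative_ident]
          has_derivative_minus[OF has_derivative_gradient(1)[OF assms]]]])
      (simp add: fun_eq_iff complex_eq_iff)
  note this = has_derivative_pd_unique[OF this]
  then show ?thesis
    by (simp add: beltrami_def complex_eq_iff)
qed

section \<open>From a punctured disk to a removable singularity\<close>

lemma punctured_disk_imp_removable:
  assumes "punctured_disk_structure U p \<phi>"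
  shows "removable_singularity U p \<phi>"
proof -
  define D where "D = {z::complex. 0 < cmod z \<and> cmod z < 1}"
  have D: "D = ball 0 1 - {0}" by (auto simp: D_def)
  obtain V f where V: "open V" "p \<in> V" "V \<subseteq> U"
    and bi: "biholomorphism_onto (hessian_metric \<phi>) (V - {p}) D f"
    and lim: "(f \<longlongrightarrow> 0) (at p)" "(inv_into (V - {p}) f \<longlongrightarrow> p) (at 0)"
    using assms unfolding punctured_disk_structure_def D_def by blast
  have bij: "bij_betw f (V - {p}) D" using bi by (simp add: biholomorphism_onto_def)
  define k where "k = inv_into (V - {p}) f"
  have kf: "k (f z) = z" if "z \<in> V - {p}" for z
    using bij that by (simp add: k_def bij_betw_def)
  have f0: "\<forall>\<^sub>F z in at p. z \<in> V - {p}"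
    using V by (auto simp: eventually_at_topological)
  have "\<forall>\<^sub>F z in at p. f z \<noteq> 0"
    using f0 by eventually_elim (use bij D in \<open>auto dest!: bij_betwE\<close>)
  \<comment> \<open>\<open>f\<close> avoids the value 0 off \<open>p\<close>, so limits at the
    puncture 0 can be pulled back to \<open>p\<close>.\<close>
  then have flim: "filterlim f (at 0) (at p)" using lim(1) by (simp add: filterlim_at)
  \<comment> \<open>In the disk coordinate \<open>X\<close> is holomorphic off 0 with bounded real
    part, hence converges. For the two functions used below the real part is a coordinate of
    \<open>k w\<close>, which tends to that of \<open>p\<close>.\<close>
  have key: "\<exists>l. (X \<longlongrightarrow> l) (at p)"
    if X: "\<And>z. z \<in> U - {p} \<Longrightarrow> beltrami \<phi> X z" and Re: "((\<lambda>w. Re (X (k w))) \<longlongrightarrow> c) (at 0)" for X c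
  proof -
    have hol: "(X \<circ> k) holomorphic_on ball 0 1 - {0}"
      unfolding k_def D[symmetric]
    proof (rule beltrami_holomorphic_of_biholomorphism[OF bi])
      have "V - {p} \<subseteq> U - {p}" using V(3) by blast
      then show "\<forall>z\<in>V - {p}. pdx (pdx \<phi>) z * pdy (pdy \<phi>) z - (pdy (pdx \<phi>) z)\<^sup>2 = 1"
        "\<forall>z\<in>V - {p}. 0 < pdx (pdx \<phi>) z" "\<forall>z\<in>V - {p}. beltrami \<phi> X z"
        using det pos X by blast+
    qed (simp add: D open_delete)
    have "\<forall>\<^sub>F w in at 0. dist (Re (X (k w))) c < 1" using Re by (rule tendstoD) simp
    then have "\<forall>\<^sub>F w in at 0. \<bar>Re ((X \<circ> k) w)\<bar> \<le> \<bar>c\<bar> + 1"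
      by eventually_elim (auto simp: dist_real_def)
    then obtain l where "((X \<circ> k) \<longlongrightarrow> l) (at 0)"
      using holomorphic_bounded_Re_imp_limit[OF open_ball _ hol] by auto
    then have "((\<lambda>z. (X \<circ> k) (f z)) \<longlongrightarrow> l) (at p)" using flim by (rule filterlim_compose)
    moreover have "\<forall>\<^sub>F z in at p. (X \<circ> k) (f z) = X z"
      using f0 by eventually_elim (simp add: kf)
    ultimately have "(X \<longlongrightarrow> l) (at p)" by (rule Lim_transform_eventually)
    then show ?thesis by (rule exI)
  qed
  have klim: "(k \<longlongrightarrow> p) (at 0)" using lim(2) by (simp add: k_def)
  obtain l1 where "((\<lambda>w. Complex (fst w) (pdy \<phi> w)) \<longlongrightarrow> l1) (at p)"
    using key[OF beltrami_conjugate_x, of "fst p"] tendsto_fst[OF klim] by auto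
  from tendsto_Im[OF this] have 1: "(pdy \<phi> \<longlongrightarrow> Im l1) (at p)" by simp
  obtain l2 where "((\<lambda>w. Complex (snd w) (- pdx \<phi> w)) \<longlongrightarrow> l2) (at p)"
    using key[OF beltrami_conjugate_y, of "snd p"] tendsto_snd[OF klim] by auto
  from tendsto_minus[OF tendsto_Im[OF this]] have 2: "(pdx \<phi> \<longlongrightarrow> - Im l2) (at p)" by simp
  show ?thesis
    using limit_gradient_imp_removable[OF U _ 2 1] C2 by (simp add: C2_on_def)
qed

section \<open>From a removable singularity to a punctured disk\<close>

lemma removable_imp_punctured_disk:
  assumes "removable_singularity U p \<phi>"
  shows "punctured_disk_structure U p \<phi>"
proof -
  obtain \<psi> where \<psi>: "C1_on U \<psi>" "\<forall>z\<in>U - {p}. \<psi> z = \<phi> z"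
    using assms by (auto simp: removable_singularity_def)
  have pd: "pdx \<psi> z = pdx \<phi> z" "pdy \<psi> z = pdy \<phi> z" if "z \<in> U - {p}" for z
    using pd_transform_open[of "U - {p}" z \<psi> \<phi>] \<psi>(2) that U C2_on_differentiable[OF C2]
    by (auto simp: open_delete)
  define r s t where "r = pdx (pdx \<phi>)" and "s = pdy (pdx \<phi>)" and "t = pdy (pdy \<phi>)"
  have rst: "r z * t z - (s z)\<^sup>2 = 1" "0 < r z" "0 < t z" if "z \<in> U - {p}" for z
    using det[OF that] pos[OF that] det_one_coeff_pos[OF det[OF that] pos[OF that]]
    by (auto simp: r_def s_def t_def)
  \<comment> \<open>The Lewy transform, built from \<open>\<psi>\<close> rather than
    \<open>\<phi>\<close> so that it is continuous at \<open>p\<close> as well.\<close>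
  define L where "L = (\<lambda>z. Complex (fst z + pdx \<psi> z) (snd z + pdy \<psi> z))"
  have contL: "continuous_on U L"
    using \<psi>(1) unfolding L_def C1_on_def by (intro continuous_intros) auto
  have dL: "(L has_derivative (\<lambda>v. Complex (fst v + (fst v * r z + snd v * s z))
      (snd v + (fst v * s z + snd v * t z)))) (at z)" if z: "z \<in> U - {p}" for z
  proof (rule has_derivative_transform_within_open[OF _ _ z])
    show "((\<lambda>z. Complex (fst z + pdx \<phi> z) (snd z + pdy \<phi> z)) has_derivative
      (\<lambda>v. Complex (fst v + (fst v * r z + snd v * s z)) (snd v + (fst v * s z + snd v * t z)))) (at z)"
      unfolding r_def s_def t_def
      by (intro has_derivative_Complex has_derivative_add has_derivative_fst has_derivative_snd
          has_derivative_ident has_derivative_gradient z)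
  qed (use U pd in \<open>auto simp: L_def open_delete\<close>)
  obtain \<delta> where \<delta>: "0 < \<delta>" "ball p \<delta> \<subseteq> U" using U by (meson openE)
  define B where "B = ball p \<delta>"
  have B: "open B" "p \<in> B" "B \<subseteq> U" using \<delta> by (auto simp: B_def)
  \<comment> \<open>The inner product of \<open>w - z\<close> with the increment of
    \<open>L\<close>. Bounding it below by the squared distance makes \<open>L\<close> strongly
    monotone, hence injective.\<close>
  define m where "m = (\<lambda>z w. (fst w - fst z) * (Re (L w) - Re (L z)) + (snd w - snd z) * (Im (L w) - Im (L z)))"
  have mono_seg: "(norm (w - z))\<^sup>2 \<le> m z w"
    if zw: "z \<in> B" "w \<in> B" "p \<notin> closed_segment z w" for z w
  proof -
    define v1 v2 where "v1 = fst w - fst z" and "v2 = snd w - snd z"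
    define c where "c = (\<lambda>u. z + u *\<^sub>R (w - z))"
    have c: "c u \<in> U - {p}" if "0 \<le> u" "u \<le> 1" for u
    proof -
      have "c u = (1 - u) *\<^sub>R z + u *\<^sub>R w" by (simp add: c_def algebra_simps)
      then have "c u \<in> closed_segment z w" using that by (auto simp: closed_segment_def)
      then show ?thesis
        using zw B closed_segment_subset[of z B w] by (auto simp: B_def)
    qed
    \<comment> \<open>The Hessian quadratic form at \<open>c u\<close> in the direction
      \<open>w - z\<close>.\<close>
    define q where "q = (\<lambda>u. v1\<^sup>2 * r (c u) + 2 * v1 * v2 * s (c u) + v2\<^sup>2 * t (c u))"
    have "((\<lambda>u. v1 * Re (L (c u)) + v2 * Im (L (c u))) has_real_derivative (v1\<^sup>2 + v2\<^sup>2 + q u)) (at u)"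
      if "0 \<le> u" "u \<le> 1" for u
    proof -
      have "(c has_derivative (\<lambda>h. h *\<^sub>R (w - z))) (at u)"
        unfolding c_def by (auto intro!: derivative_eq_intros)
      note dLc = has_derivative_compose[OF this dL[OF c[OF that]]]
      show ?thesis
        unfolding has_field_derivative_def
        by (rule has_derivative_eq_rhs, (rule derivative_intros bounded_linear.has_derivative[OF bounded_linear_Re]
            bounded_linear.has_derivative[OF bounded_linear_Im] dLc)+)
          (simp add: fun_eq_iff q_def v1_def v2_def power2_eq_square algebra_simps)
    qed
    from MVT2[of 0 1, OF _ this]
    obtain u where u: "0 < u" "u < 1" "v1 * Re (L (c 1)) + v2 * Im (L (c 1))
        - (v1 * Re (L (c 0)) + v2 * Im (L (c 0))) = v1\<^sup>2 + v2\<^sup>2 + q u"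
      by auto
    have cu: "c u \<in> U - {p}" using c u by simp
    \<comment> \<open>Completing the square shows that the form is nonnegative.\<close>
    have "r (c u) * q u = (r (c u) * v1 + s (c u) * v2)\<^sup>2 + (r (c u) * t (c u) - (s (c u))\<^sup>2) * v2\<^sup>2"
      by (simp add: q_def power2_eq_square algebra_simps)
    also have "\<dots> \<ge> 0" unfolding rst(1)[OF cu] by simp
    finally have "0 \<le> q u" using rst(2)[OF cu] by (simp add: zero_le_mult_iff)
    moreover have "m z w = v1\<^sup>2 + v2\<^sup>2 + q u"
      using u(3) by (simp add: m_def v1_def v2_def c_def algebra_simps)
    moreover have "(norm (w - z))\<^sup>2 = v1\<^sup>2 + v2\<^sup>2"
      by (simp add: norm_prod_def v1_def v2_def)
    ultimately show ?thesis by linarith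
  qed
  have mono: "(norm (w - z))\<^sup>2 \<le> m z w" if zw: "z \<in> B" "w \<in> B" "z \<noteq> p" for z w
  proof (rule segment_closed_condition_extends[OF B(1) zw(3,2), where a = "\<lambda>w. (norm (w - z))\<^sup>2" and b = "m z"])
    have "isCont L w"
      using contL U zw B by (auto simp: continuous_on_eq_continuous_at)
    then have "isCont (\<lambda>w. Re (L w)) w" "isCont (\<lambda>w. Im (L w)) w"
      by (rule bounded_linear.isCont[OF bounded_linear_Re] bounded_linear.isCont[OF bounded_linear_Im])+
    then show "isCont (m z) w" unfolding m_def by (intro continuous_intros)
    show "isCont (\<lambda>w. (norm (w - z))\<^sup>2) w" by (intro continuous_intros)
  qed (use mono_seg zw in auto)
  have injL: "inj_on L B"
  proof (rule inj_onI)
    fix z w assume *: "z \<in> B" "w \<in> B" "L z = L w"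
    \<comment> \<open>Both orders are used because \<open>mono\<close> requires its first point to
      differ from \<open>p\<close>; of two distinct points at least one does.\<close>
    then have "m z w = 0" "m w z = 0" by (auto simp: m_def)
    then show "z = w" using mono[of z w] mono[of w z] * by auto
  qed
  have "open (L ` B)"
    by (rule invariance_of_domain_gen[OF B(1) continuous_on_subset[OF contL B(3)] injL]) simp
  then obtain \<rho> where \<rho>: "0 < \<rho>" "ball (L p) \<rho> \<subseteq> L ` B" using B(2) by (meson imageI openE)
  \<comment> \<open>Recentred and rescaled so that the disk of radius \<open>\<rho>\<close> about
    \<open>L p\<close>, contained in the image of \<open>B\<close>, becomes the unit disk.\<close>
  define f where "f = (\<lambda>z. (1 / \<rho>) *\<^sub>R (L z - L p))"
  have contf: "continuous_on U f" unfolding f_def by (intro continuous_intros contL)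
  have injf: "inj_on f B" using injL \<rho> by (auto simp: inj_on_def f_def)
  define V where "V = B \<inter> f -` ball 0 1"
  have fp: "f p = 0" by (simp add: f_def)
  have V: "open V" "p \<in> V" "V \<subseteq> U" "V \<subseteq> B"
    using continuous_open_preimage[OF continuous_on_subset[OF contf B(3)] B(1) open_ball] B fp
    by (auto simp: V_def)
  have fV: "f ` V = ball 0 1"
  proof
    show "ball 0 1 \<subseteq> f ` V"
    proof
      fix w :: complex assume w: "w \<in> ball 0 1"
      have "L p + \<rho> *\<^sub>R w \<in> ball (L p) \<rho>" using w \<rho> by (simp add: dist_norm)
      with \<rho>(2) have "L p + \<rho> *\<^sub>R w \<in> L ` B" by (rule subsetD)
      then obtain z where z: "L p + \<rho> *\<^sub>R w = L z" "z \<in> B" by (rule imageE)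
      from z(1)[symmetric] have "f z = w" using \<rho> by (simp add: f_def)
      then show "w \<in> f ` V" using z(2) w by (auto simp: V_def)
    qed
  qed (auto simp: V_def)
  have injV: "inj_on f V" using injf V(4) by (rule inj_on_subset)
  have contV: "continuous_on V f" using contf V(3) by (rule continuous_on_subset)
  have hom: "V homeomorphic (ball 0 1 :: complex set)"
    using invariance_of_domain_homeomorphic[OF V(1) contV _ injV] by (simp add: fV)
  have imV: "f ` (V - {p}) = {z. 0 < cmod z \<and> cmod z < 1}"
    using inj_on_image_set_diff[OF injV, of V "{p}"] V(2) by (auto simp: fV fp)
  have injV': "inj_on f (V - {p})" using injV by (rule inj_on_subset) auto
  have df: "(f has_derivative (\<lambda>v. fst v *\<^sub>R ((1 / \<rho>) *\<^sub>R Complex (1 + r z) (s z))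
      + snd v *\<^sub>R ((1 / \<rho>) *\<^sub>R Complex (s z) (1 + t z)))) (at z)" if "z \<in> U - {p}" for z
    unfolding f_def
    by (rule has_derivative_eq_rhs, (rule derivative_intros dL[OF that])+)
      (simp add: fun_eq_iff complex_eq_iff algebra_simps add_divide_distrib)
  note pdf = has_derivative_pd_unique[OF df]
  have sub: "V - {p} \<subseteq> U - {p}" using V by auto
  \<comment> \<open>\<open>f\<close> is itself an isothermal chart on the whole of
    \<open>V - {p}\<close>.\<close>
  have chart: "(V - {p}, f) \<in> isothermal_atlas (hessian_metric \<phi>) (V - {p})"
    unfolding isothermal_atlas_def mem_Collect_eq case_prod_conv
  proof (intro conjI ballI)
    show "open (V - {p})" using V(1) by (rule open_delete)
    show "inj_on f (V - {p})" by fact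
    have "continuous_on (V - {p}) r" "continuous_on (V - {p}) s" "continuous_on (V - {p}) t"
      using C2 continuous_on_subset[OF _ sub] by (auto simp: C2_on_def C1_on_def r_def s_def t_def)
    then have pdc: "continuous_on (V - {p}) (\<lambda>z. (1 / \<rho>) *\<^sub>R Complex (1 + r z) (s z))"
      "continuous_on (V - {p}) (\<lambda>z. (1 / \<rho>) *\<^sub>R Complex (s z) (1 + t z))"
      by (auto intro!: continuous_intros)
    have "continuous_on (V - {p}) (pdx f)"
      by (rule continuous_on_eq[OF pdc(1)]) (rule pdf(2)[OF subsetD[OF sub], symmetric])
    moreover have "continuous_on (V - {p}) (pdy f)"
      by (rule continuous_on_eq[OF pdc(2)]) (rule pdf(3)[OF subsetD[OF sub], symmetric])
    ultimately show "C1_on (V - {p}) f" unfolding C1_on_def using pdf(1) sub by blast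
    fix z assume z: "z \<in> V - {p}"
    then have z': "z \<in> U - {p}" using sub by blast
    have F: "frechet_derivative f (at z) = (\<lambda>v. fst v *\<^sub>R ((1 / \<rho>) *\<^sub>R Complex (1 + r z) (s z))
      + snd v *\<^sub>R ((1 / \<rho>) *\<^sub>R Complex (s z) (1 + t z)))"
      using frechet_derivative_at[OF df[OF z']] by simp
    have s2: "s z * s z = r z * t z - 1" using rst(1)[OF z'] by (simp add: power2_eq_square)
    show "\<exists>c>0. \<forall>v w. frechet_derivative f (at z) v \<bullet> frechet_derivative f (at z) w
        = c * hessian_metric \<phi> z v w"
    \<comment> \<open>By Cayley-Hamilton the squared differential of \<open>L\<close> is
      \<open>2 + r z + t z\<close> times the Hessian; the scaling of \<open>f\<close> contributes
      the denominator.\<close>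
    proof (intro exI[of _ "(2 + r z + t z) / \<rho>\<^sup>2"] conjI allI)
      show "0 < (2 + r z + t z) / \<rho>\<^sup>2" using rst[OF z'] \<rho> by simp
      fix v w :: "real \<times> real"
      have "\<rho>\<^sup>2 * (frechet_derivative f (at z) v \<bullet> frechet_derivative f (at z) w)
        = (fst v * (1 + r z) + snd v * s z) * (fst w * (1 + r z) + snd w * s z)
        + (fst v * s z + snd v * (1 + t z)) * (fst w * s z + snd w * (1 + t z))"
        using \<rho>(1) unfolding F inner_complex_def by (simp add: power2_eq_square field_simps)
      also have "\<dots> = (2 + r z + t z) * hessian_metric \<phi> z v w"
        using s2 unfolding hessian_metric_def r_def[symmetric] s_def[symmetric] t_def[symmetric]
        by algebra
      finally show "frechet_derivative f (at z) v \<bullet> frechet_derivative f (at z) w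
        = (2 + r z + t z) / \<rho>\<^sup>2 * hessian_metric \<phi> z v w" using \<rho>(1) by (simp add: field_simps)
    qed
    \<comment> \<open>The Jacobian of \<open>L\<close> is det(I + H) = 1 + tr H + det H = 2 + tr
      H.\<close>
    have "Im (cnj (pdx f z) * pdy f z) = (2 + r z + t z) / \<rho>\<^sup>2"
      using \<rho>(1) s2 unfolding pdf[OF z'] by (simp add: power2_eq_square field_simps)
    then show "0 < Im (cnj (pdx f z) * pdy f z)" using rst[OF z'] \<rho> by simp
  qed auto
  have bi: "biholomorphism_onto (hessian_metric \<phi>) (V - {p}) {z. 0 < cmod z \<and> cmod z < 1} f"
    unfolding biholomorphism_onto_def
  proof (intro conjI ballI)
    show "bij_betw f (V - {p}) {z. 0 < cmod z \<and> cmod z < 1}"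
      using injV' imV by (simp add: bij_betw_def)
    fix q assume q: "q \<in> V - {p}"
    \<comment> \<open>With \<open>f\<close> as the chart around every \<open>q\<close>, both
      compositions are the identity.\<close>
    have "(f \<circ> inv_into (V - {p}) f) holomorphic_on (f ` (V - {p}))"
      by (rule holomorphic_transform[OF holomorphic_on_id]) (simp add: f_inv_into_f)
    then show "\<exists>(W, \<zeta>)\<in>isothermal_atlas (hessian_metric \<phi>) (V - {p}). q \<in> W \<and>
        (f \<circ> inv_into W \<zeta>) holomorphic_on (\<zeta> ` W) \<and>
        (\<zeta> \<circ> inv_into (V - {p}) f) holomorphic_on (f ` W)"
      using chart q by (intro bexI[of _ "(V - {p}, f)"]) auto
  qed
  have limf: "(f \<longlongrightarrow> 0) (at p)"
    using contf U fp by (auto simp: continuous_on_eq_continuous_at isCont_def)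
  have "continuous_on (ball 0 1) (inv_into V f)"
    using continuous_on_inverse_open[OF V(1) contV, of "inv_into V f"] injV by (simp add: fV)
  moreover have "inv_into V f 0 = p" using inv_into_f_f[OF injV V(2)] by (simp add: fp)
  ultimately have "(inv_into V f \<longlongrightarrow> p) (at 0)"
    by (auto simp: continuous_on_eq_continuous_at isCont_def)
  \<comment> \<open>The inverse on all of \<open>V\<close> is continuous at 0; off 0 it agrees with
    the inverse on \<open>V - {p}\<close>, so the limit carries over.\<close>
  moreover have "\<forall>\<^sub>F w in at 0. inv_into V f w = inv_into (V - {p}) f w"
  proof -
    have "inv_into V f w = inv_into (V - {p}) f w" if "w \<in> f ` (V - {p})" for w
    proof -
      obtain z where z: "z \<in> V - {p}" "w = f z" using \<open>w \<in> f ` (V - {p})\<close> by blast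
      then show ?thesis using inv_into_f_f[OF injV, of z] inv_into_f_f[OF injV' z(1)] by simp
    qed
    then show ?thesis
      unfolding imV by (auto simp: eventually_at dist_norm intro!: exI[of _ 1])
  qed
  ultimately have "(inv_into (V - {p}) f \<longlongrightarrow> p) (at 0)" by (rule Lim_transform_eventually)
  then show ?thesis
    unfolding punctured_disk_structure_def using V hom bi limf by blast
qed

end

theorem lemma5:
  fixes U :: "(real \<times> real) set" and x0 y0 :: real and \<phi> :: "real \<times> real \<Rightarrow> real"
  assumes "open U" and "(x0, y0) \<in> U"
    and "C2_on (U - {(x0, y0)}) \<phi>"
    and "\<forall>z\<in>U - {(x0, y0)}. pdx (pdx \<phi>) z * pdy (pdy \<phi>) z - (pdy (pdx \<phi>) z)\<^sup>2 = 1"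
    and "\<forall>z\<in>U - {(x0, y0)}. pdx (pdx \<phi>) z > 0"
  shows "removable_singularity U (x0, y0) \<phi> \<longleftrightarrow> punctured_disk_structure U (x0, y0) \<phi>"
  using removable_imp_punctured_disk[OF assms(1-3)] punctured_disk_imp_removable[OF assms(1-3)] assms(4,5)
  by blast

end
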